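(* Let $n\geq 2$, let $X$ and $Y$ be real $n$-normed spaces, and let $\phi\colon X\to Y$ be a lineation such that for all $x_0,x_1,\dots,x_n\in X$ \[ \|x_1-x_0,\dots,x_n-x_0\|=1 \implies \|\phi(x_1)-\phi(x_0),\dots,\phi(x_n)-\phi(x_0)\|=1 . \] Then $\phi$ is an affine $n$-isometry, i.e. $\phi$ is affine and \[ \|x_1-x_0,\dots,x_n-x_0\|=\|\phi(x_1)-\phi(x_0),\dots,\phi(x_n)-\phi(x_0)\| \qquad \text{for all } x_0,\dots,x_n\in X . \]
   Context: A (real) $n$-normed space is a real vector space $X$ with $\dim X\geq n$ (possibly infinite-dimensional) together with a function $\|\cdot,\dots,\cdot\|\colon X^n\to[0,\infty)$ (an $n$-norm) such that for all $x_1,\dots,x_n,\widetilde x_1\in X$: (1) $\|x_1,\dots,x_n\|=0$ if and only if $x_1,\dots,x_n$ are linearly dependent; (2) $\|x_1,\dots,x_n\|=\|x_{\sigma(1)},\dots,x_{\sigma(n)}\|$ for every permutation $\sigma\in S_n$; (3) $\|\alpha x_1,x_2,\dots,x_n\|=|\alpha|\,\|x_1,x_2,\dots,x_n\|$ for every $\alpha\in\mathbb{R}$; (4) $\|x_1+\widetilde x_1,x_2,\dots,x_n\|\leq\|x_1,x_2,\dots,x_n\|+\|\widetilde x_1,x_2,\dots,x_n\|$. The $n$-norms on $X$ and on $Y$ are denoted by the same symbol. A map $\eta\colon X\to Y$ between real vector spaces is a lineation if it maps any three collinear points of $X$ into collinear points of $Y$. An affine map is the sum of a linear map and a constant. *)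

theory Defs
  imports "HOL-Analysis.Analysis" "HOL-Combinatorics.Permutations"
begin

text \<open>
  Linear dependence of a finite family, given as a list. In contrast to the library's
  \<^const>\<open>dependent\<close>, which is a property of sets, a list with a repeated entry is dependent.
\<close>

definition lin_dependent_list :: "'a::real_vector list \<Rightarrow> bool" where
  "lin_dependent_list xs \<longleftrightarrow>
     (\<exists>c :: nat \<Rightarrow> real. (\<exists>i<length xs. c i \<noteq> 0) \<and> (\<Sum>i<length xs. c i *\<^sub>R xs ! i) = 0)"

text \<open>
  The underlying vector space is the whole type \<^typ>\<open>'a\<close>, and an $n$-tuple is a list of length
  \<open>n\<close>; the values of \<open>N\<close> on lists of other lengths are irrelevant. The dimension condition is
  phrased through independent sets because \<^const>\<open>dim\<close> is \<open>0\<close> on infinite-dimensional spaces.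
\<close>

locale n_normed_space =
  fixes n :: nat and N :: "'a::real_vector list \<Rightarrow> real"
  assumes dim_ge: "\<exists>B :: 'a set. finite B \<and> independent B \<and> card B = n"
    and nonneg: "length xs = n \<Longrightarrow> 0 \<le> N xs"
    and eq_0_iff: "length xs = n \<Longrightarrow> N xs = 0 \<longleftrightarrow> lin_dependent_list xs"
    and permute: "length xs = n \<Longrightarrow> \<sigma> permutes {..<n} \<Longrightarrow> N (permute_list \<sigma> xs) = N xs"
    and scale: "length (x # xs) = n \<Longrightarrow> N ((\<alpha> *\<^sub>R x) # xs) = \<bar>\<alpha>\<bar> * N (x # xs)"
    and triangle: "length (x # xs) = n \<Longrightarrow> N ((x + x') # xs) \<le> N (x # xs) + N (x' # xs)"

definition lineation :: "('a::real_vector \<Rightarrow> 'b::real_vector) \<Rightarrow> bool" where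
  "lineation f \<longleftrightarrow> (\<forall>x y z. collinear {x, y, z} \<longrightarrow> collinear {f x, f y, f z})"

definition affine_map :: "('a::real_vector \<Rightarrow> 'b::real_vector) \<Rightarrow> bool" where
  "affine_map f \<longleftrightarrow> (\<exists>L c. linear L \<and> (\<forall>x. f x = L x + c))"

text \<open>In the following, \<open>xs\<close> lists the points $x_1,\dots,x_n$.\<close>

definition preserves_unit_n_distance ::
  "nat \<Rightarrow> ('a::real_vector list \<Rightarrow> real) \<Rightarrow> ('b::real_vector list \<Rightarrow> real) \<Rightarrow> ('a \<Rightarrow> 'b) \<Rightarrow> bool" where
  "preserves_unit_n_distance n N M f \<longleftrightarrow>
     (\<forall>x0 xs. length xs = n \<longrightarrow> N (map (\<lambda>x. x - x0) xs) = 1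
        \<longrightarrow> M (map (\<lambda>x. f x - f x0) xs) = 1)"

definition n_isometry ::
  "nat \<Rightarrow> ('a::real_vector list \<Rightarrow> real) \<Rightarrow> ('b::real_vector list \<Rightarrow> real) \<Rightarrow> ('a \<Rightarrow> 'b) \<Rightarrow> bool" where
  "n_isometry n N M f \<longleftrightarrow>
     (\<forall>x0 xs. length xs = n \<longrightarrow> N (map (\<lambda>x. x - x0) xs) = M (map (\<lambda>x. f x - f x0) xs))"

end

theory Submission
  imports Defs
begin

text \<open>
  Any two independent vectors \<open>u\<close>, \<open>v\<close> extend to an independent \<open>n\<close>-tuple, and a scaling of one
  entry gives this tuple norm one. The image tuple then has norm one, so it is independent as well.
  Hence \<open>\<phi>\<close> is injective and maps noncollinear triples to noncollinear triples
  (\<open>image_lin_indep\<close>); with the lineation property it maps lines into lines and planes into planes.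

  Incidence alone does not visibly give parallelism, because the image of a line is not known to
  be a whole line. The norm supplies it (\<open>image_parallel\<close>): the points at which a fixed base,
  completed by a varying apex, has norm one include a parallel to an edge of the base. The images
  of the apexes lie on one line in the image plane, where the norm measures the distance from the
  line through the image of the edge; an affine function whose absolute value is one at three
  distinct points is constant, so the two image lines are parallel.

  Proper parallelograms therefore go to parallelograms (\<open>image_parallelogram\<close>), so the displacement
  \<open>\<phi> (x + u) - \<phi> x\<close> does not depend on \<open>x\<close> and is additive in \<open>u\<close>. As lines are mapped into
  lines, scaling by \<open>t\<close> becomes scaling by a factor \<open>\<sigma> t\<close>, which does not depend on the vector
  (\<open>linear_part_uniform_factor\<close>). Then \<open>\<sigma>\<close> is a ring endomorphism of the reals, hence the identity
  (\<open>real_ring_endo_eq_id\<close>), and \<open>\<phi>\<close> is affine. Homogeneity in one entry carries the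
  preservation of the norm from the value one to every positive value; dependent tuples are mapped
  to dependent ones by linearity.
\<close>

section \<open>Linear independence of lists\<close>

text \<open>This reduction gives access to the theory of bases of sets.\<close>

lemma lin_dependent_list_iff:
  "lin_dependent_list xs \<longleftrightarrow> \<not> distinct xs \<or> dependent (set xs)"
proof (cases "distinct xs")
  case True
  have bij: "bij_betw ((!) xs) {..<length xs} (set xs)"
    using True by (rule bij_betw_nth) auto
  have reindex: "(\<Sum>i<length xs. f (xs ! i) *\<^sub>R xs ! i) = (\<Sum>v\<in>set xs. f v *\<^sub>R v)" for f
    using sum.reindex_bij_betw[OF bij, of "\<lambda>v. f v *\<^sub>R v"] .
  show ?thesis
  proof
    assume "lin_dependent_list xs"
    then obtain c i where c: "i < length xs" "c i \<noteq> 0" "(\<Sum>i<length xs. c i *\<^sub>R xs ! i) = 0"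
      unfolding lin_dependent_list_def by blast
    define f where "f = (\<lambda>v. c (the_inv_into {..<length xs} ((!) xs) v))"
    have f: "f (xs ! j) = c j" if "j < length xs" for j
      using that bij unfolding f_def bij_betw_def by (simp add: the_inv_into_f_f)
    have "(\<Sum>v\<in>set xs. f v *\<^sub>R v) = 0"
      unfolding reindex[symmetric] using c(3) by (simp add: f)
    moreover have "f (xs ! i) \<noteq> 0" "xs ! i \<in> set xs"
      using c f by auto
    ultimately show "\<not> distinct xs \<or> dependent (set xs)"
      by (auto simp: dependent_finite)
  next
    assume "\<not> distinct xs \<or> dependent (set xs)"
    then obtain f v where "v \<in> set xs" "f v \<noteq> 0" "(\<Sum>v\<in>set xs. f v *\<^sub>R v) = 0"
      using True by (auto simp: dependent_finite)
    then show "lin_dependent_list xs"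
      unfolding lin_dependent_list_def
      by (intro exI[of _ "\<lambda>i. f (xs ! i)"]) (auto simp: reindex in_set_conv_nth)
  qed
next
  case False
  then obtain i j where ij: "i < length xs" "j < length xs" "i \<noteq> j" "xs ! i = xs ! j"
    by (auto simp: distinct_conv_nth)
  have "(\<Sum>k<length xs. (if k = i then 1 else if k = j then - 1 else (0::real)) *\<^sub>R xs ! k)
      = (\<Sum>k\<in>{i, j}. (if k = i then 1 else if k = j then - 1 else (0::real)) *\<^sub>R xs ! k)"
    using ij by (intro sum.mono_neutral_right) auto
  also have "\<dots> = 0"
    using ij by simp
  finally show ?thesis
    using False ij unfolding lin_dependent_list_def
    by (auto intro!: exI[of _ "\<lambda>k. if k = i then 1 else if k = j then - 1 else 0"])
qed

lemma lin_dependent_list_append: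
  "lin_dependent_list xs \<Longrightarrow> lin_dependent_list (xs @ ys)"
  using dependent_mono[of "set xs" "set (xs @ ys)"] by (auto simp: lin_dependent_list_iff)

lemma not_lin_dependent_list_pair_iff:
  "\<not> lin_dependent_list [u, v] \<longleftrightarrow> (\<forall>a b. a *\<^sub>R u + b *\<^sub>R v = 0 \<longrightarrow> a = 0 \<and> b = 0)"
proof
  assume indep: "\<not> lin_dependent_list [u, v]"
  show "\<forall>a b. a *\<^sub>R u + b *\<^sub>R v = 0 \<longrightarrow> a = 0 \<and> b = 0"
  proof (intro allI impI)
    fix a b :: real
    assume "a *\<^sub>R u + b *\<^sub>R v = 0"
    then show "a = 0 \<and> b = 0"
      using indep unfolding lin_dependent_list_def
      by (auto simp: numeral_2_eq_2 less_Suc_eq dest!: spec[of _ "\<lambda>i. if i = 0 then a else b"])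
  qed
next
  assume "\<forall>a b. a *\<^sub>R u + b *\<^sub>R v = 0 \<longrightarrow> a = 0 \<and> b = 0"
  then show "\<not> lin_dependent_list [u, v]"
    unfolding lin_dependent_list_def by (force simp: numeral_2_eq_2 less_Suc_eq)
qed

lemma lin_indep_pairD:
  assumes "\<not> lin_dependent_list [u, v]" "a *\<^sub>R u + b *\<^sub>R v = 0"
  shows "a = 0" "b = 0"
  using assms by (auto simp: not_lin_dependent_list_pair_iff)

lemma lin_indep_pair_coeffs_unique:
  assumes "\<not> lin_dependent_list [u, v]" "a *\<^sub>R u + b *\<^sub>R v = c *\<^sub>R u + d *\<^sub>R v"
  shows "a = c" "b = d"
  using lin_indep_pairD[OF assms(1), of "a - c" "b - d"] assms(2)
  by (auto simp: algebra_simps)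

lemma lin_indep_pair_nonzero:
  assumes "\<not> lin_dependent_list [u, v]"
  shows "u \<noteq> 0" "v \<noteq> 0"
  using lin_indep_pairD[OF assms, of 1 0] lin_indep_pairD[OF assms, of 0 1] by auto

lemma lin_indep_pair_commute:
  "\<not> lin_dependent_list [u, v] \<Longrightarrow> \<not> lin_dependent_list [v, u]"
  by (auto simp: lin_dependent_list_iff insert_commute)

lemma lin_indep_pair_shear:
  assumes "\<not> lin_dependent_list [u, v]" "d \<noteq> 0"
  shows "\<not> lin_dependent_list [u, c *\<^sub>R u + d *\<^sub>R v]"
  unfolding not_lin_dependent_list_pair_iff
proof (intro allI impI)
  fix a b
  assume "a *\<^sub>R u + b *\<^sub>R (c *\<^sub>R u + d *\<^sub>R v) = 0"
  then have "(a + b * c) *\<^sub>R u + (b * d) *\<^sub>R v = 0"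
    by (simp add: algebra_simps)
  from lin_indep_pairD[OF assms(1) this] show "a = 0 \<and> b = 0"
    using assms(2) by auto
qed

lemma lin_indep_pair_or_multiple:
  assumes "u \<noteq> 0"
  shows "\<not> lin_dependent_list [u, v] \<or> (\<exists>c. v = c *\<^sub>R u)"
proof (rule disjCI)
  assume "\<nexists>c. v = c *\<^sub>R u"
  then have no: "v \<noteq> c *\<^sub>R u" for c
    by blast
  show "\<not> lin_dependent_list [u, v]"
    unfolding not_lin_dependent_list_pair_iff
  proof (intro allI impI)
    fix a b
    assume eq: "a *\<^sub>R u + b *\<^sub>R v = 0"
    have "b = 0"
    proof (rule ccontr)
      assume "b \<noteq> 0"
      have "b *\<^sub>R v = - (a *\<^sub>R u)"
        using eq by (simp add: eq_neg_iff_add_eq_0 add.commute)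
      then have "v = (1 / b) *\<^sub>R - (a *\<^sub>R u)"
        using \<open>b \<noteq> 0\<close> by (metis divide_self_if scaleR_one scaleR_scaleR times_divide_eq_left mult_1)
      then have "v = (- a / b) *\<^sub>R u"
        by simp
      then show False
        using no by blast
    qed
    then show "a = 0 \<and> b = 0"
      using eq assms by simp
  qed
qed

lemma collinear_multiple:
  assumes "collinear {x, y, z}" "x \<noteq> y"
  obtains k where "z - x = k *\<^sub>R (y - x)"
proof -
  obtain w where w: "\<And>p q. p \<in> {x, y, z} \<Longrightarrow> q \<in> {x, y, z} \<Longrightarrow> \<exists>c. p - q = c *\<^sub>R w"
    using assms(1) unfolding collinear_def by blast
  obtain a b where ab: "y - x = a *\<^sub>R w" "z - x = b *\<^sub>R w"
    using w[of y x] w[of z x] by auto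
  then have "a \<noteq> 0"
    using assms(2) by auto
  then have "z - x = (b / a) *\<^sub>R (y - x)"
    using ab by simp
  then show ?thesis
    using that by blast
qed

lemma collinear_on_line: "collinear {x + a *\<^sub>R w, x + b *\<^sub>R w, x + c *\<^sub>R w}"
  unfolding collinear_def
proof (intro exI[of _ w] ballI)
  fix p q
  assume "p \<in> {x + a *\<^sub>R w, x + b *\<^sub>R w, x + c *\<^sub>R w}" "q \<in> {x + a *\<^sub>R w, x + b *\<^sub>R w, x + c *\<^sub>R w}"
  then obtain s t where "p = x + s *\<^sub>R w" "q = x + t *\<^sub>R w"
    by blast
  then have "p - q = (s - t) *\<^sub>R w"
    by (simp add: algebra_simps)
  then show "\<exists>c. p - q = c *\<^sub>R w" ..
qed

section \<open>Elementary properties of an n-norm\<close>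

context n_normed_space
begin

lemma swap:
  assumes "length (x # y # ws) = n"
  shows "N (y # x # ws) = N (x # y # ws)"
proof -
  have "permute_list (Transposition.transpose 0 1) (x # y # ws) = y # x # ws"
    by (rule nth_equalityI)
      (auto simp: permute_list_def Transposition.transpose_def nth_Cons split: nat.split simp del: upt_Suc)
  moreover have "Transposition.transpose 0 1 permutes {..<n}"
    using assms by (intro permutes_swap_id) auto
  ultimately show ?thesis
    using permute[OF assms] by metis
qed

lemma scale_second:
  assumes "length (x # y # ws) = n"
  shows "N (x # (\<alpha> *\<^sub>R y) # ws) = \<bar>\<alpha>\<bar> * N (x # y # ws)"
  using scale[of y "x # ws" \<alpha>] swap[of x "\<alpha> *\<^sub>R y" ws] swap[of x y ws] assms by simp

lemma lin_indep_pair_if_nonzero: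
  assumes "length (x # y # ws) = n" "N (x # y # ws) \<noteq> 0"
  shows "\<not> lin_dependent_list [x, y]"
  using lin_dependent_list_append[of "[x, y]" ws] eq_0_iff[of "x # y # ws"] assms by auto

lemma shear_second:
  assumes len: "length (x # y # ws) = n"
  shows "N (x # (y + c *\<^sub>R x) # ws) = N (x # y # ws)"
proof -
  have mult: "N ((d *\<^sub>R x) # x # ws) = 0" for d
    using lin_indep_pair_if_nonzero[of x x ws] scale[of x "x # ws" d] len
    by (auto simp: lin_dependent_list_iff)
  have le: "N ((z + d *\<^sub>R x) # x # ws) \<le> N (z # x # ws)" for z d
    using triangle[of z "x # ws" "d *\<^sub>R x"] mult[of d] len by simp
  have "N ((y + c *\<^sub>R x) # x # ws) = N (y # x # ws)"
    using le[of y c] le[of "y + c *\<^sub>R x" "- c"] by simp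
  then show ?thesis
    using swap[of x "y + c *\<^sub>R x" ws] swap[of x y ws] len by simp
qed

text \<open>
  A basis of the whole space that contains the given vectors has at least \<open>n\<close> elements, by
  Steinitz exchange against the independent set that the dimension condition provides.
\<close>

lemma extend_lin_indep:
  assumes indep: "\<not> lin_dependent_list us" and len: "length us \<le> n"
  obtains ws where "length (us @ ws) = n" "N (us @ ws) > 0"
proof -
  have us: "distinct us" "independent (set us)"
    using indep by (auto simp: lin_dependent_list_iff)
  obtain A where A: "set us \<subseteq> A" "independent A" "UNIV \<subseteq> span A"
    using maximal_independent_subset_extend[of "set us" UNIV] us by auto
  obtain B where B: "finite (B :: 'a set)" "independent B" "card B = n"
    using dim_ge by blast
  have card_A: "n \<le> card A" if "finite A"
    using independent_span_bound[OF that B(2)] A(3) B(3) by auto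
  have "\<exists>C \<subseteq> A - set us. finite C \<and> card C = n - length us"
  proof (cases "finite A")
    case True
    then have "n - length us \<le> card (A - set us)"
      using card_A A(1) us(1) by (simp add: card_Diff_subset distinct_card)
    then show ?thesis
      using obtain_subset_with_card_n[of "n - length us" "A - set us"] by metis
  next
    case False
    then show ?thesis
      using infinite_arbitrarily_large[of "A - set us" "n - length us"] by auto
  qed
  then obtain C where C: "C \<subseteq> A - set us" "finite C" "card C = n - length us"
    by blast
  obtain ws where ws: "set ws = C" "distinct ws"
    using finite_distinct_list[OF C(2)] by blast
  have "length ws = n - length us"
    using ws C(3) distinct_card by metis
  then have length: "length (us @ ws) = n"
    using len by simp
  have "independent (set (us @ ws))"
    using A(1) C(1) ws(1) by (intro independent_mono[OF A(2)]) auto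
  then have "\<not> lin_dependent_list (us @ ws)"
    using us(1) ws C(1) by (auto simp: lin_dependent_list_iff)
  then have "N (us @ ws) > 0"
    using eq_0_iff[OF length] nonneg[OF length] by linarith
  with length show ?thesis
    using that by blast
qed

end

section \<open>Ring endomorphisms of the reals\<close>

text \<open>
  Squares go to squares, so a ring endomorphism is monotone; being the identity on integers, it
  then moves \<open>k * t\<close> by at most one for every \<open>k\<close>, hence \<open>t\<close> by at most \<open>1 / k\<close>.
\<close>

lemma real_ring_endo_eq_id:
  fixes \<sigma> :: "real \<Rightarrow> real"
  assumes add: "\<And>s t. \<sigma> (s + t) = \<sigma> s + \<sigma> t"
    and mult: "\<And>s t. \<sigma> (s * t) = \<sigma> s * \<sigma> t"
    and one: "\<sigma> 1 = 1"
  shows "\<sigma> t = t"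
proof -
  have zero: "\<sigma> 0 = 0"
    using add[of 0 0] by simp
  have minus: "\<sigma> (- s) = - \<sigma> s" for s
    using add[of s "- s"] zero by simp
  have nat: "\<sigma> (real k) = real k" for k
    by (induction k) (simp_all add: zero add one)
  have int: "\<sigma> (of_int m) = of_int m" for m
    by (cases m rule: int_cases2) (simp_all add: nat minus)
  have mono: "\<sigma> r \<le> \<sigma> s" if "r \<le> s" for r s
  proof -
    have "\<sigma> (s - r) = \<sigma> (sqrt (s - r)) * \<sigma> (sqrt (s - r))"
      using that by (simp flip: mult)
    then have "0 \<le> \<sigma> (s - r)"
      by simp
    then show ?thesis
      using add[of "s - r" r] by simp
  qed
  have bound: "real k * \<bar>\<sigma> t - t\<bar> \<le> 1" for k
  proof -
    define m where "m = \<lfloor>real k * t\<rfloor>"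
    have m: "of_int m \<le> real k * t" "real k * t \<le> of_int (m + 1)"
      unfolding m_def by linarith+
    have "of_int m \<le> real k * \<sigma> t" "real k * \<sigma> t \<le> of_int (m + 1)"
      using mono[OF m(1)] mono[OF m(2)] by (simp_all only: mult nat int)
    then have "\<bar>real k * \<sigma> t - real k * t\<bar> \<le> 1"
      using m by simp
    then show ?thesis
      by (simp add: abs_mult flip: right_diff_distrib)
  qed
  show ?thesis
  proof (rule ccontr)
    assume "\<sigma> t \<noteq> t"
    then obtain k where "1 < real k * \<bar>\<sigma> t - t\<bar>"
      using reals_Archimedean3[of "\<bar>\<sigma> t - t\<bar>"] by auto
    then show False
      using bound[of k] by simp
  qed
qed

section \<open>Lineations that preserve the unit n-distance\<close>

locale unit_n_distance_lineation =
  X: n_normed_space n N + Y: n_normed_space n M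
  for n :: nat and N :: "'a::real_vector list \<Rightarrow> real" and M :: "'b::real_vector list \<Rightarrow> real" +
  fixes \<phi> :: "'a \<Rightarrow> 'b"
  assumes n_ge_2: "n \<ge> 2"
    and lineation: "lineation \<phi>"
    and preserves_unit: "preserves_unit_n_distance n N M \<phi>"
begin

lemma unit:
  assumes "length us = n" "N us = 1"
  shows "M (map (\<lambda>u. \<phi> (x + u) - \<phi> x) us) = 1"
proof -
  have "map (\<lambda>p. p - x) (map (\<lambda>u. x + u) us) = us"
    by (simp add: comp_def)
  then show ?thesis
    using preserves_unit[unfolded preserves_unit_n_distance_def, rule_format,
        of "map (\<lambda>u. x + u) us" x] assms by (simp add: comp_def)
qed

lemma extend_pair:
  assumes "\<not> lin_dependent_list [u, v]"
  obtains ws where "length (u # v # ws) = n" "N (u # v # ws) > 0"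
  using X.extend_lin_indep[OF assms] n_ge_2 by auto

lemma exists_lin_indep:
  fixes u :: 'a
  assumes "u \<noteq> 0"
  obtains v where "\<not> lin_dependent_list [u, v]"
proof -
  have "\<not> lin_dependent_list [u]"
    using assms by (simp add: lin_dependent_list_iff)
  then obtain ws where ws: "length ([u] @ ws) = n" "N ([u] @ ws) > 0"
    using X.extend_lin_indep[of "[u]"] n_ge_2 by auto
  then obtain v vs where "ws = v # vs"
    using n_ge_2 by (cases ws) auto
  then show ?thesis
    using X.lin_indep_pair_if_nonzero[of u v vs] ws that by simp
qed

text \<open>
  After the scaling, the two vectors start a tuple of norm one; its image has norm one, and a tuple
  of nonzero norm has independent entries. The scaling is removed in \<open>image_lin_indep\<close>.
\<close>

lemma scaled_second_image_lin_indep: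
  assumes "\<not> lin_dependent_list [u, v]"
  obtains c where "c > 0"
    "\<And>x. \<not> lin_dependent_list [\<phi> (x + u) - \<phi> x, \<phi> (x + c *\<^sub>R v) - \<phi> x]"
proof -
  obtain ws where ws: "length (u # v # ws) = n" "N (u # v # ws) > 0"
    using extend_pair[OF assms] .
  define c where "c = 1 / N (u # v # ws)"
  have c: "c > 0"
    using ws unfolding c_def by simp
  have one: "N (u # (c *\<^sub>R v) # ws) = 1"
    using X.scale_second[OF ws(1), of c] ws(2) unfolding c_def by simp
  have "\<not> lin_dependent_list [\<phi> (x + u) - \<phi> x, \<phi> (x + c *\<^sub>R v) - \<phi> x]" for x
    using Y.lin_indep_pair_if_nonzero[of _ _ "map (\<lambda>u. \<phi> (x + u) - \<phi> x) ws"]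
      unit[OF _ one, of x] ws(1) by simp
  then show ?thesis
    using that c by blast
qed

lemma image_nonzero:
  assumes "u \<noteq> 0"
  shows "\<phi> (x + u) \<noteq> \<phi> x"
proof -
  obtain v where "\<not> lin_dependent_list [u, v]"
    using exists_lin_indep[OF assms] .
  then obtain c where "\<not> lin_dependent_list [\<phi> (x + u) - \<phi> x, \<phi> (x + c *\<^sub>R v) - \<phi> x]"
    using scaled_second_image_lin_indep by metis
  from lin_indep_pair_nonzero(1)[OF this] show ?thesis
    by simp
qed

lemma injective: "\<phi> x = \<phi> y \<Longrightarrow> x = y"
  using image_nonzero[of "x - y" y] by auto

lemma image_line:
  assumes "u \<noteq> 0"
  obtains k where "\<phi> (x + t *\<^sub>R u) - \<phi> x = k *\<^sub>R (\<phi> (x + u) - \<phi> x)"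
proof -
  have "collinear {\<phi> x, \<phi> (x + u), \<phi> (x + t *\<^sub>R u)}"
    using lineation collinear_on_line[of x 0 u 1 t] unfolding lineation_def by simp
  then show ?thesis
    using collinear_multiple[of "\<phi> x" "\<phi> (x + u)" "\<phi> (x + t *\<^sub>R u)"]
      image_nonzero[OF assms, of x] that by metis
qed

lemma image_lin_indep:
  assumes "\<not> lin_dependent_list [u, v]"
  shows "\<not> lin_dependent_list [\<phi> (x + u) - \<phi> x, \<phi> (x + v) - \<phi> x]"
proof -
  obtain c where c: "c > 0"
    "\<not> lin_dependent_list [\<phi> (x + u) - \<phi> x, \<phi> (x + c *\<^sub>R v) - \<phi> x]"
    using scaled_second_image_lin_indep[OF assms] by blast
  have v: "c *\<^sub>R v \<noteq> 0"
    using lin_indep_pair_nonzero(2)[OF assms] c(1) by simp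
  obtain k where k: "\<phi> (x + v) - \<phi> x = k *\<^sub>R (\<phi> (x + c *\<^sub>R v) - \<phi> x)"
    using image_line[OF v, of x "1 / c"] c(1) by auto
  have "k \<noteq> 0"
    using k image_nonzero[of v x] v by auto
  then show ?thesis
    using lin_indep_pair_shear[OF c(2), of k 0] unfolding k by simp
qed

text \<open>
  A point of the plane off the two axes is the midpoint of a point on one axis and a point on the
  other, and the images of these two points are distinct.
\<close>

lemma image_plane:
  assumes "\<not> lin_dependent_list [u, v]"
  obtains a b where "\<phi> (x + s *\<^sub>R u + t *\<^sub>R v) - \<phi> x =
    a *\<^sub>R (\<phi> (x + u) - \<phi> x) + b *\<^sub>R (\<phi> (x + v) - \<phi> x)"
proof -
  define p q where "p = (2 * s) *\<^sub>R u" and "q = (2 * t) *\<^sub>R v"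
  note nz = lin_indep_pair_nonzero[OF assms]
  have mid: "s *\<^sub>R u + t *\<^sub>R v = p + (1/2) *\<^sub>R (q - p)"
    unfolding p_def q_def by (simp add: algebra_simps flip: scaleR_left.add)
  obtain a where a: "\<phi> (x + p) - \<phi> x = a *\<^sub>R (\<phi> (x + u) - \<phi> x)"
    unfolding p_def using image_line[OF nz(1)] .
  obtain b where b: "\<phi> (x + q) - \<phi> x = b *\<^sub>R (\<phi> (x + v) - \<phi> x)"
    unfolding q_def using image_line[OF nz(2)] .
  show ?thesis
  proof (cases "p = q")
    case True
    then have "(2 * s) *\<^sub>R u + (- (2 * t)) *\<^sub>R v = 0"
      unfolding p_def q_def by simp
    from lin_indep_pairD[OF assms this] show ?thesis
      using that[of 0 0] by simp
  next
    case False
    obtain k where "\<phi> (x + s *\<^sub>R u + t *\<^sub>R v) - \<phi> (x + p) = k *\<^sub>R (\<phi> (x + q) - \<phi> (x + p))"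
      using image_line[of "q - p" "x + p" "1/2"] False mid by (auto simp: add.assoc)
    then have "\<phi> (x + s *\<^sub>R u + t *\<^sub>R v) - \<phi> x
        = (\<phi> (x + p) - \<phi> x) + k *\<^sub>R ((\<phi> (x + q) - \<phi> x) - (\<phi> (x + p) - \<phi> x))"
      by (simp add: algebra_simps)
    also have "\<dots> = ((1 - k) * a) *\<^sub>R (\<phi> (x + u) - \<phi> x) + (k * b) *\<^sub>R (\<phi> (x + v) - \<phi> x)"
      unfolding a b by (simp add: algebra_simps)
    finally show ?thesis
      by (rule that)
  qed
qed

text \<open>
  This is where the norm forces more than incidence. Scale \<open>u\<close> so that the simplex with base
  edge \<open>u\<close> and apex \<open>x + v\<close> has unit norm. Moving the apex along the parallel to \<open>u\<close> keeps the
  norm, so the image of the apex runs along a line on which the norm stays one. In the image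
  plane the norm, as a function of the apex, is a multiple of the distance from the base line;
  three distinct points of a line at the same distance from the base line force parallelism.
\<close>

lemma image_parallel:
  assumes indep: "\<not> lin_dependent_list [u, v]"
  obtains k where "\<phi> (x + v + u) - \<phi> (x + v) = k *\<^sub>R (\<phi> (x + u) - \<phi> x)"
proof -
  obtain ws where ws: "length (u # v # ws) = n" "N (u # v # ws) > 0"
    using extend_pair[OF indep] .
  define c where "c = 1 / N (u # v # ws)"
  define u' where "u' = c *\<^sub>R u"
  have c: "c > 0"
    using ws unfolding c_def by simp
  have u: "u \<noteq> 0" "u' \<noteq> 0" "u = (1 / c) *\<^sub>R u'"
    using lin_indep_pair_nonzero(1)[OF indep] c unfolding u'_def by simp_all
  have indep': "\<not> lin_dependent_list [u', v]"
    using lin_indep_pair_commute[OF lin_indep_pair_shear[OF lin_indep_pair_commute[OF indep], of c 0]] c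
    unfolding u'_def by simp
  have unit_norm: "N (u' # (v + t *\<^sub>R u) # ws) = 1" for t
  proof -
    have "N (u' # v # ws) = 1"
      using X.scale[of u "v # ws" c] ws unfolding u'_def by (simp add: c_def)
    moreover have "t *\<^sub>R u = (t * (1 / c)) *\<^sub>R u'"
      using u(3) by (metis scaleR_scaleR)
    ultimately show ?thesis
      using X.shear_second[of u' v ws "t * (1 / c)"] ws by simp
  qed
  define U A b where "U = \<phi> (x + u') - \<phi> x" and "A = \<phi> (x + v) - \<phi> x"
    and "b = \<phi> (x + v + u) - \<phi> (x + v)"
  define W where "W = map (\<lambda>u. \<phi> (x + u) - \<phi> x) ws"
  have len: "length (U # y # W) = n" for y
    using ws unfolding W_def by simp
  have unit_image: "M (U # (\<phi> (x + v + t *\<^sub>R u) - \<phi> x) # W) = 1" for t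
    using unit[OF _ unit_norm[of t], of x] ws unfolding U_def W_def by (simp add: add.assoc)
  obtain \<beta>' \<gamma>' where "\<phi> (x + (1 / c) *\<^sub>R u' + 1 *\<^sub>R v) - \<phi> x = \<beta>' *\<^sub>R U + \<gamma>' *\<^sub>R A"
    unfolding U_def A_def using image_plane[OF indep'] .
  then have "b = \<beta>' *\<^sub>R U + (\<gamma>' - 1) *\<^sub>R A"
    unfolding b_def A_def by (simp add: u(3) algebra_simps)
  then obtain \<beta> \<gamma> where b: "b = \<beta> *\<^sub>R U + \<gamma> *\<^sub>R A"
    by blast
  \<comment> \<open>The apex image \<open>A + \<tau> b\<close> has height \<open>1 + \<tau> \<gamma>\<close> over the line spanned by \<open>U\<close>.\<close>
  have height: "\<bar>1 + \<tau> * \<gamma>\<bar> = 1" if "\<phi> (x + v + t *\<^sub>R u) - \<phi> (x + v) = \<tau> *\<^sub>R b" for \<tau> t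
  proof -
    have "\<phi> (x + v + t *\<^sub>R u) - \<phi> x = (1 + \<tau> * \<gamma>) *\<^sub>R A + (\<tau> * \<beta>) *\<^sub>R U"
      using that unfolding A_def b by (simp add: algebra_simps)
    then have "M (U # ((1 + \<tau> * \<gamma>) *\<^sub>R A + (\<tau> * \<beta>) *\<^sub>R U) # W) = 1"
      using unit_image[of t] by simp
    then have "\<bar>1 + \<tau> * \<gamma>\<bar> * M (U # A # W) = 1"
      using Y.shear_second[OF len] Y.scale_second[OF len] by simp
    then show ?thesis
      using unit_image[of 0] unfolding A_def by simp
  qed
  have b_nz: "b \<noteq> 0"
    unfolding b_def using image_nonzero[OF u(1), of "x + v"] by simp
  obtain \<tau> where \<tau>: "\<phi> (x + v + 2 *\<^sub>R u) - \<phi> (x + v) = \<tau> *\<^sub>R b"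
    unfolding b_def using image_line[OF u(1)] .
  have "\<tau> \<noteq> 0"
    using \<tau> injective[of "x + v + 2 *\<^sub>R u" "x + v"] u(1) by auto
  moreover have "\<tau> \<noteq> 1"
    using \<tau> injective[of "x + v + 2 *\<^sub>R u" "x + v + u"] u(1) unfolding b_def
    by (auto simp: scaleR_2)
  moreover have "\<bar>1 + \<gamma>\<bar> = 1" "\<bar>1 + \<tau> * \<gamma>\<bar> = 1"
    using height[of 1 1] height[OF \<tau>] unfolding b_def by simp_all
  \<comment> \<open>The heights at \<open>\<tau> = 1\<close> and at the third point are \<open>1\<close> or \<open>- 1\<close>, and so is the height
    at \<open>\<tau> = 0\<close>; an affine function with these values at three points is constant.\<close>
  ultimately have "\<gamma> = 0"
  proof -
    have "\<gamma> = 0 \<or> \<gamma> = - 2"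
      using \<open>\<bar>1 + \<gamma>\<bar> = 1\<close> by linarith
    moreover have False if "\<gamma> = - 2"
      using \<open>\<bar>1 + \<tau> * \<gamma>\<bar> = 1\<close> \<open>\<tau> \<noteq> 0\<close> \<open>\<tau> \<noteq> 1\<close> unfolding that by linarith
    ultimately show ?thesis
      by blast
  qed
  then have "b = \<beta> *\<^sub>R U"
    using b by simp
  moreover obtain k where "U = k *\<^sub>R (\<phi> (x + u) - \<phi> x)"
    unfolding U_def u'_def using image_line[OF u(1)] .
  ultimately have "b = (\<beta> * k) *\<^sub>R (\<phi> (x + u) - \<phi> x)"
    by simp
  then show ?thesis
    using that unfolding b_def by blast
qed

lemma image_parallelogram:
  assumes indep: "\<not> lin_dependent_list [u, v]"
  shows "\<phi> (x + v + u) - \<phi> (x + v) = \<phi> (x + u) - \<phi> x"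
proof -
  obtain k where k: "\<phi> (x + v + u) - \<phi> (x + v) = k *\<^sub>R (\<phi> (x + u) - \<phi> x)"
    using image_parallel[OF indep] .
  obtain l where l: "\<phi> (x + u + v) - \<phi> (x + u) = l *\<^sub>R (\<phi> (x + v) - \<phi> x)"
    using image_parallel[OF lin_indep_pair_commute[OF indep]] .
  have swap: "x + u + v = x + v + u"
    by (simp add: algebra_simps)
  have "k *\<^sub>R (\<phi> (x + u) - \<phi> x) + 1 *\<^sub>R (\<phi> (x + v) - \<phi> x)
      = 1 *\<^sub>R (\<phi> (x + u) - \<phi> x) + l *\<^sub>R (\<phi> (x + v) - \<phi> x)"
    by (simp flip: k l add: swap)
  from lin_indep_pair_coeffs_unique(1)[OF image_lin_indep[OF indep] this] show ?thesis
    using k by simp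
qed

text \<open>
  For dependent \<open>u\<close> and \<open>v\<close> the parallelogram degenerates; a detour through \<open>x + w\<close> off the line
  replaces it by two proper ones.
\<close>

lemma image_translation:
  "\<phi> (x + v + u) - \<phi> (x + v) = \<phi> (x + u) - \<phi> x"
proof (cases "u = 0")
  case False
  show ?thesis
  proof (cases "lin_dependent_list [u, v]")
    case True
    then obtain c where c: "v = c *\<^sub>R u"
      using lin_indep_pair_or_multiple[OF False] by blast
    obtain w where w: "\<not> lin_dependent_list [u, w]"
      using exists_lin_indep[OF False] .
    have "\<not> lin_dependent_list [u, v - w]"
      using lin_indep_pair_shear[OF w, of "- 1" c] c by simp
    from image_parallelogram[OF this, of "x + w"] show ?thesis
      using image_parallelogram[OF w, of x] by simp
  qed (rule image_parallelogram)
qed simp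

definition linear_part :: "'a \<Rightarrow> 'b" where
  "linear_part u = \<phi> u - \<phi> 0"

lemma diff_eq_linear_part: "\<phi> (x + u) - \<phi> x = linear_part u"
  using image_translation[of 0 x u] by (simp add: linear_part_def)

lemma linear_part_add: "linear_part (u + v) = linear_part u + linear_part v"
  using diff_eq_linear_part[of v u] by (simp add: linear_part_def algebra_simps)

lemma linear_part_eq_0_iff: "linear_part u = 0 \<longleftrightarrow> u = 0"
  using injective[of u 0] by (auto simp: linear_part_def)

lemma linear_part_lin_indep:
  "\<not> lin_dependent_list [u, v] \<Longrightarrow> \<not> lin_dependent_list [linear_part u, linear_part v]"
  using image_lin_indep[of u v 0] by (simp add: linear_part_def)

lemma linear_part_line:
  assumes "u \<noteq> 0"
  obtains k where "linear_part (t *\<^sub>R u) = k *\<^sub>R linear_part u"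
  using image_line[OF assms, of 0 t] by (auto simp: linear_part_def)

text \<open>The factor by which \<open>t *\<^sub>R u\<close> is stretched is the same for all \<open>u\<close>, by similar triangles.\<close>

lemma linear_part_factor_unique:
  assumes "\<not> lin_dependent_list [u, v]"
    and "linear_part (t *\<^sub>R u) = k *\<^sub>R linear_part u"
  shows "linear_part (t *\<^sub>R v) = k *\<^sub>R linear_part v"
proof -
  note nz = lin_indep_pair_nonzero[OF assms(1)]
  obtain l where l: "linear_part (t *\<^sub>R v) = l *\<^sub>R linear_part v"
    using linear_part_line[OF nz(2)] .
  have "u + v \<noteq> 0"
    using lin_indep_pairD[OF assms(1), of 1 1] by auto
  then obtain m where "linear_part (t *\<^sub>R (u + v)) = m *\<^sub>R linear_part (u + v)"
    using linear_part_line by blast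
  then have "k *\<^sub>R linear_part u + l *\<^sub>R linear_part v = m *\<^sub>R linear_part u + m *\<^sub>R linear_part v"
    by (simp add: scaleR_add_right linear_part_add assms(2) l)
  from lin_indep_pair_coeffs_unique[OF linear_part_lin_indep[OF assms(1)] this]
  show ?thesis
    using l by simp
qed

lemma linear_part_uniform_factor:
  obtains \<sigma> where "\<And>t u. linear_part (t *\<^sub>R u) = \<sigma> t *\<^sub>R linear_part u"
proof (cases "\<exists>e :: 'a. e \<noteq> 0")
  case True
  then obtain e :: 'a where e: "e \<noteq> 0"
    by blast
  have "\<exists>k. linear_part (t *\<^sub>R e) = k *\<^sub>R linear_part e" for t
    using linear_part_line[OF e] by metis
  then obtain \<sigma> where \<sigma>: "\<And>t. linear_part (t *\<^sub>R e) = \<sigma> t *\<^sub>R linear_part e"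
    by metis
  have indep: "linear_part (t *\<^sub>R u) = \<sigma> t *\<^sub>R linear_part u" if "\<not> lin_dependent_list [e, u]" for t u
    using linear_part_factor_unique[OF that \<sigma>] .
  have "linear_part (t *\<^sub>R u) = \<sigma> t *\<^sub>R linear_part u" for t u
  proof (cases "u = 0 \<or> \<not> lin_dependent_list [e, u]")
    case True
    then show ?thesis
      using indep linear_part_eq_0_iff[of 0] by auto
  next
    case False
    then obtain c where c: "u = c *\<^sub>R e" "c \<noteq> 0"
      using lin_indep_pair_or_multiple[OF e, of u] by auto
    obtain w where w: "\<not> lin_dependent_list [e, w]"
      using exists_lin_indep[OF e] .
    have "\<not> lin_dependent_list [w, u]"
      using lin_indep_pair_shear[OF lin_indep_pair_commute[OF w] c(2), of 0] c(1) by simp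
    then show ?thesis
      using linear_part_factor_unique indep[OF w] by blast
  qed
  then show ?thesis
    using that by blast
next
  case False
  then have "u = 0" for u :: 'a
    by blast
  then show ?thesis
    using that[of "\<lambda>t. t"] linear_part_eq_0_iff by (metis scaleR_zero_right)
qed

lemma linear_part_scaleR: "linear_part (t *\<^sub>R u) = t *\<^sub>R linear_part u"
proof (cases "u = 0")
  case True
  then show ?thesis
    using linear_part_eq_0_iff[of 0] by simp
next
  case False
  obtain \<sigma> where \<sigma>: "\<And>t u. linear_part (t *\<^sub>R u) = \<sigma> t *\<^sub>R linear_part u"
    using linear_part_uniform_factor by blast
  have cancel: "a = b" if "a *\<^sub>R linear_part u = b *\<^sub>R linear_part u" for a b
    using that False linear_part_eq_0_iff by simp
  have "\<sigma> t = t"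
  proof (rule real_ring_endo_eq_id)
    show "\<sigma> (r + s) = \<sigma> r + \<sigma> s" for r s
      by (rule cancel) (simp add: scaleR_add_left linear_part_add flip: \<sigma>)
    show "\<sigma> (r * s) = \<sigma> r * \<sigma> s" for r s
    proof (rule cancel)
      have "\<sigma> (r * s) *\<^sub>R linear_part u = linear_part (r *\<^sub>R (s *\<^sub>R u))"
        by (simp flip: \<sigma>)
      then show "\<sigma> (r * s) *\<^sub>R linear_part u = (\<sigma> r * \<sigma> s) *\<^sub>R linear_part u"
        unfolding \<sigma> by simp
    qed
    show "\<sigma> 1 = 1"
      by (rule cancel) (simp flip: \<sigma>)
  qed
  then show ?thesis
    using \<sigma> by simp
qed

lemma linear_linear_part: "linear linear_part"
  by (intro linearI linear_part_add linear_part_scaleR)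

lemma linear_part_norm:
  assumes len: "length us = n"
  shows "M (map linear_part us) = N us"
proof (cases "N us = 0")
  case True
  interpret linear linear_part
    by (rule linear_linear_part)
  obtain c where "\<exists>i<length us. c i \<noteq> 0" and c: "(\<Sum>i<length us. c i *\<^sub>R us ! i) = 0"
    using True X.eq_0_iff[OF len] unfolding lin_dependent_list_def by blast
  moreover have "(\<Sum>i<length us. c i *\<^sub>R map linear_part us ! i) = 0"
    using arg_cong[OF c, of linear_part] by (simp add: sum scale zero)
  ultimately have "lin_dependent_list (map linear_part us)"
    unfolding lin_dependent_list_def by auto
  then show ?thesis
    using True Y.eq_0_iff[of "map linear_part us"] len by simp
next
  case False
  then have pos: "N us > 0"
    using X.nonneg[OF len] by simp
  obtain u ws where us: "us = u # ws"
    using len n_ge_2 by (cases us) auto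
  define c where "c = 1 / N us"
  have "N ((c *\<^sub>R u) # ws) = 1"
    using X.scale[of u ws c] pos len unfolding us c_def by simp
  then have "M (map linear_part ((c *\<^sub>R u) # ws)) = 1"
    using unit[of "(c *\<^sub>R u) # ws" 0] len unfolding us diff_eq_linear_part by simp
  then have "\<bar>c\<bar> * M (map linear_part us) = 1"
    using Y.scale[of "linear_part u" "map linear_part ws" c] len
    unfolding us by (simp add: linear_part_scaleR)
  then show ?thesis
    using pos unfolding c_def by (simp add: field_simps)
qed

lemma affine_map_phi: "affine_map \<phi>"
  unfolding affine_map_def
  using linear_linear_part by (intro exI[of _ linear_part] exI[of _ "\<phi> 0"]) (simp add: linear_part_def)

lemma n_isometry_phi: "n_isometry n N M \<phi>"
  unfolding n_isometry_def
proof (intro allI impI)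
  fix x0 :: 'a and xs :: "'a list"
  assume len: "length xs = n"
  have "\<phi> x - \<phi> x0 = linear_part (x - x0)" for x
    using diff_eq_linear_part[of x0 "x - x0"] by simp
  then show "N (map (\<lambda>x. x - x0) xs) = M (map (\<lambda>x. \<phi> x - \<phi> x0) xs)"
    using linear_part_norm[of "map (\<lambda>x. x - x0) xs"] len by (simp add: comp_def)
qed

end

theorem corollary3:
  fixes n :: nat
    and N :: "'a::real_vector list \<Rightarrow> real"
    and M :: "'b::real_vector list \<Rightarrow> real"
    and \<phi> :: "'a \<Rightarrow> 'b"
  assumes "n \<ge> 2"
    and "n_normed_space n N"
    and "n_normed_space n M"
    and "lineation \<phi>"
    and "preserves_unit_n_distance n N M \<phi>"
  shows "affine_map \<phi> \<and> n_isometry n N M \<phi>"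
proof -
  interpret unit_n_distance_lineation n N M \<phi>
    using assms by (simp add: unit_n_distance_lineation_def unit_n_distance_lineation_axioms_def)
  show ?thesis
    using affine_map_phi n_isometry_phi by blast
qed

end
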